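(* Let $\psi(\varepsilon,d)=[g(d)+k]\,\psi_0^+(\varepsilon)+(1+k)\,\psi_0^-(\varepsilon)$, $\varepsilon\in\mathbb{S}^m$, $d\in[0,1]$, with the isotropic volumetric splitting $$\psi_0^+(\varepsilon)=\Big(\frac{\mu}{m}+\frac{\lambda}{2}\Big)(\operatorname{tr}\varepsilon)^2,\qquad \psi_0^-(\varepsilon)=\mu\operatorname{dev}\varepsilon:\operatorname{dev}\varepsilon .$$ Then: (P1) $\psi(\varepsilon,\cdot)\in C^2$ for all $\varepsilon\in\mathbb{S}^m$, and $\psi(\cdot,d)\in C^{1,1}$ for all $d\in[0,1]$. (P2) The gradient $\nabla\psi(\cdot,d)$ is semismooth for all $d\in[0,1]$. (P3) There is $L\ge0$ independent of $d$ with $|\nabla\psi(A,d)-\nabla\psi(B,d)|\le L|A-B|_F$ for all $A,B\in\mathbb{S}^m$. (P4) There is $\eta>0$ independent of $d$ such that $\psi(tA+(1-t)B,d)\le t\psi(A,d)+(1-t)\psi(B,d)-\frac12\eta t(1-t)|A-B|_F^2$ for all $A,B\in\mathbb{S}^m$, $t\in[0,1]$. (P5) There is $C>0$ independent of $d$ such that $\psi(\varepsilon,d)\ge C|\varepsilon|_F^2$ for all $\varepsilon\in\mathbb{S}^m$. Furthermore, $\psi(\cdot,d)$ is in $C^\infty$ and quadratic for all $d\in[0,1]$.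
   Context: $\mathbb{S}^m$ is the space of real symmetric $m\times m$ matrices with Frobenius norm $|\cdot|_F$; $\operatorname{dev}\varepsilon=\varepsilon-\frac{\operatorname{tr}\varepsilon}{m}I$ and $A:B=\operatorname{tr}(A^TB)$. $\mu>0$ and $\lambda>-\tfrac23\mu$ are such that $\psi_0(\varepsilon)=\frac{\lambda}{2}(\operatorname{tr}\varepsilon)^2+\mu\operatorname{tr}(\varepsilon^2)$ is strongly convex on $\mathbb{S}^m$ (automatic for $m\le3$). $g:[0,1]\to[0,1]$ is convex, twice continuously differentiable, monotone decreasing with $g(0)=1$, $g(1)=0$; $k>0$ is a constant. $\nabla\psi(\cdot,d)$ is the gradient with respect to the matrix argument. $C^{1,1}$ means differentiable with locally Lipschitz continuous derivative. A locally Lipschitz map $F:\mathbb{S}^m\to\mathbb{S}^m$ is semismooth if for every $A,V\in\mathbb{S}^m$ the limit $\lim_{n\to\infty}G_nV_n$ exists and is the same for all sequences $V_n\to V$, $t_n\searrow0$, $G_n\in\partial F(A+t_nV_n)$, where $\partial F$ is Clarke's generalized Jacobian. *)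

theory Defs
  imports "HOL-Analysis.Analysis"
begin

section \<open>The Euclidean space of real symmetric matrices\<close>

text \<open>
  A type of its own, so that derivatives, gradients and Clarke Jacobians are
  taken in the space of symmetric matrices and not in the space of all square matrices.
\<close>

typedef 'm symmat = "{A :: real^'m^'m. transpose A = A}"
  morphisms mat_of Symmat
  by (rule exI[of _ "mat 1"]) simp

setup_lifting type_definition_symmat

lemma transpose_mat_of [simp]: "transpose (mat_of A) = mat_of A"
  using mat_of[of A] by simp

instantiation symmat :: (finite) real_vector
begin

lift_definition zero_symmat :: "'a symmat" is 0
  by (simp add: transpose_def vec_eq_iff)

lift_definition plus_symmat :: "'a symmat \<Rightarrow> 'a symmat \<Rightarrow> 'a symmat" is "(+)"
  by (simp add: transpose_def vec_eq_iff)

lift_definition minus_symmat :: "'a symmat \<Rightarrow> 'a symmat \<Rightarrow> 'a symmat" is "(-)"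
  by (simp add: transpose_def vec_eq_iff)

lift_definition uminus_symmat :: "'a symmat \<Rightarrow> 'a symmat" is uminus
  by (simp add: transpose_def vec_eq_iff)

lift_definition scaleR_symmat :: "real \<Rightarrow> 'a symmat \<Rightarrow> 'a symmat" is "(*\<^sub>R)"
  by (simp add: transpose_def vec_eq_iff)

instance
  by standard (transfer, simp add: algebra_simps)+

end

text \<open>The identity matrix; not declared as an instance of class \<open>one\<close>, because
  the space of symmetric matrices is not closed under multiplication.\<close>

lift_definition Id_symmat :: "'m::finite symmat" is "mat 1"
  by simp

definition tr :: "'m::finite symmat \<Rightarrow> real" where
  "tr A = trace (mat_of A)"

lemma trace_transpose_mult_eq_inner:
  fixes A B :: "real^'m^'m"
  shows "trace (transpose A ** B) = A \<bullet> B"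
proof -
  have "trace (transpose A ** B) = (\<Sum>i\<in>UNIV. \<Sum>k\<in>UNIV. A$k$i * B$k$i)"
    by (simp add: trace_def matrix_matrix_mult_def transpose_def)
  also have "\<dots> = (\<Sum>k\<in>UNIV. \<Sum>i\<in>UNIV. A$k$i * B$k$i)"
    by (rule sum.swap)
  finally show ?thesis
    by (simp add: inner_vec_def)
qed

instantiation symmat :: (finite) real_inner
begin

definition inner_symmat :: "'a symmat \<Rightarrow> 'a symmat \<Rightarrow> real" where
  "inner_symmat A B = trace (transpose (mat_of A) ** mat_of B)"

definition norm_symmat :: "'a symmat \<Rightarrow> real" where
  "norm_symmat A = sqrt (A \<bullet> A)"

definition sgn_symmat :: "'a symmat \<Rightarrow> 'a symmat" where
  "sgn_symmat A = A /\<^sub>R norm A"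

definition dist_symmat :: "'a symmat \<Rightarrow> 'a symmat \<Rightarrow> real" where
  "dist_symmat A B = norm (A - B)"

definition uniformity_symmat :: "('a symmat \<times> 'a symmat) filter" where
  "uniformity_symmat = (INF e\<in>{0<..}. principal {(A, B). dist A B < e})"

definition open_symmat :: "'a symmat set \<Rightarrow> bool" where
  "open_symmat U \<longleftrightarrow> (\<forall>A\<in>U. eventually (\<lambda>(A', B). A' = A \<longrightarrow> B \<in> U) uniformity)"

instance
proof
  fix A B C :: "'a symmat" and r :: real
  have [simp]: "X \<bullet> Y = mat_of X \<bullet> mat_of Y" for X Y :: "'a symmat"
    by (simp only: inner_symmat_def trace_transpose_mult_eq_inner)
  show "sgn A = A /\<^sub>R norm A"
    by (rule sgn_symmat_def)
  show "dist A B = norm (A - B)"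
    by (rule dist_symmat_def)
  show "(uniformity :: ('a symmat \<times> 'a symmat) filter) =
      (INF e\<in>{0<..}. principal {(A, B). dist A B < e})"
    by (rule uniformity_symmat_def)
  show "open U \<longleftrightarrow> (\<forall>A\<in>U. eventually (\<lambda>(A', B). A' = A \<longrightarrow> B \<in> U) uniformity)"
    for U :: "'a symmat set"
    by (rule open_symmat_def)
  show "A \<bullet> B = B \<bullet> A"
    by (simp add: inner_commute)
  show "(A + B) \<bullet> C = A \<bullet> C + B \<bullet> C"
    by (simp add: plus_symmat.rep_eq inner_add_left)
  show "(r *\<^sub>R A) \<bullet> B = r * (A \<bullet> B)"
    by (simp add: scaleR_symmat.rep_eq)
  show "0 \<le> A \<bullet> A"
    by simp
  show "A \<bullet> A = 0 \<longleftrightarrow> A = 0"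
    by (simp add: zero_symmat.rep_eq[symmetric] mat_of_inject)
  show "norm A = sqrt (A \<bullet> A)"
    by (rule norm_symmat_def)
qed

end

lemma inner_symmat_eq: "A \<bullet> B = mat_of A \<bullet> mat_of B"
  by (simp only: inner_symmat_def trace_transpose_mult_eq_inner)

lemma ex_symmat_basis:
  "\<exists>B :: 'm::finite symmat set. B \<noteq> {} \<and> finite B \<and>
     (\<forall>u\<in>B. \<forall>v\<in>B. u \<bullet> v = (if u = v then 1 else 0)) \<and>
     (\<forall>x. (\<forall>u\<in>B. x \<bullet> u = 0) \<longleftrightarrow> x = 0)"
proof -
  let ?S = "{A :: real^'m^'m. transpose A = A}"
  have sub: "subspace ?S"
    by (auto simp: subspace_def transpose_def vec_eq_iff)
  obtain B where B: "B \<subseteq> ?S" "pairwise orthogonal B" "\<And>x. x \<in> B \<Longrightarrow> norm x = 1"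
      "independent B" "span B = ?S"
    by (rule orthonormal_basis_subspace[OF sub]) (rule that)
  have fin: "finite B"
    using B(4) by (rule independent_imp_finite)
  define B' where "B' = Symmat ` B"
  have im: "mat_of ` B' = B"
  proof -
    have "mat_of (Symmat X) = X" if "X \<in> B" for X
      using B(1) that by (auto intro: Symmat_inverse)
    then show ?thesis
      by (simp add: B'_def image_image)
  qed
  have one: "u \<bullet> v = (if u = v then 1 else 0)" if "u \<in> B'" "v \<in> B'" for u v
  proof -
    have m: "mat_of u \<in> B" "mat_of v \<in> B"
      using im that by auto
    show ?thesis
    proof (cases "u = v")
      case True
      then show ?thesis
        using B(3)[OF m(1)] by (simp add: inner_symmat_eq norm_eq_1)
    next
      case False
      then have "mat_of u \<noteq> mat_of v"
        by (simp add: mat_of_inject)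
      then show ?thesis
        using pairwiseD[OF B(2) m] False by (simp add: inner_symmat_eq orthogonal_def)
    qed
  qed
  have zero: "x = 0" if "\<forall>u\<in>B'. x \<bullet> u = 0" for x
  proof -
    have "orthogonal (mat_of x) y" if y: "y \<in> B" for y
    proof -
      obtain u where "u \<in> B'" "y = mat_of u"
        using y im by blast
      then show ?thesis
        using \<open>\<forall>u\<in>B'. x \<bullet> u = 0\<close> by (simp add: inner_symmat_eq orthogonal_def)
    qed
    moreover have "mat_of x \<in> span B"
      using B(5) by simp
    ultimately have "orthogonal (mat_of x) (mat_of x)"
      by (meson orthogonal_to_span)
    then show ?thesis
      by (simp add: orthogonal_def zero_symmat.rep_eq[symmetric] mat_of_inject)
  qed
  have ne: "B' \<noteq> {}"
  proof
    assume "B' = {}"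
    then have "Id_symmat = (0 :: 'm symmat)"
      using zero by blast
    then have "mat 1 = (0 :: real^'m^'m)"
      by transfer
    then have "(mat 1 :: real^'m^'m) $ i $ i = 0" for i
      by simp
    then show False
      by (simp add: mat_def)
  qed
  show ?thesis
  proof (intro exI[of _ B'] conjI ballI allI iffI)
    show "finite B'"
      using fin by (simp add: B'_def)
  qed (use ne one zero in \<open>simp_all\<close>)
qed

instantiation symmat :: (finite) euclidean_space
begin

text \<open>The choice of the orthonormal basis is immaterial.\<close>

definition Basis_symmat :: "'a symmat set" where
  "Basis_symmat = (SOME B. B \<noteq> {} \<and> finite B \<and>
     (\<forall>u\<in>B. \<forall>v\<in>B. u \<bullet> v = (if u = v then 1 else 0)) \<and>
     (\<forall>x. (\<forall>u\<in>B. x \<bullet> u = 0) \<longleftrightarrow> x = 0))"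

instance
proof
  have B: "Basis \<noteq> ({} :: 'a symmat set) \<and> finite (Basis :: 'a symmat set) \<and>
     (\<forall>u\<in>Basis. \<forall>v\<in>(Basis :: 'a symmat set). u \<bullet> v = (if u = v then 1 else 0)) \<and>
     (\<forall>x :: 'a symmat. (\<forall>u\<in>Basis. x \<bullet> u = 0) \<longleftrightarrow> x = 0)"
    unfolding Basis_symmat_def by (rule someI_ex) (rule ex_symmat_basis)
  show "(Basis :: 'a symmat set) \<noteq> {}" "finite (Basis :: 'a symmat set)"
    using B by simp_all
  show "u \<bullet> v = (if u = v then 1 else 0)" if "u \<in> Basis" "v \<in> Basis" for u v :: "'a symmat"
    using B that by simp
  show "(\<forall>u\<in>Basis. x \<bullet> u = 0) \<longleftrightarrow> x = 0" for x :: "'a symmat"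
    using B by simp
qed

end

definition dev :: "'m::finite symmat \<Rightarrow> 'm symmat" where
  "dev A = A - (tr A / real CARD('m)) *\<^sub>R Id_symmat"

section \<open>Notions from nonsmooth analysis\<close>

definition strongly_convex :: "('a::real_normed_vector \<Rightarrow> real) \<Rightarrow> bool" where
  "strongly_convex f \<longleftrightarrow> (\<exists>\<eta>>0. \<forall>x y. \<forall>t\<in>{0..1}.
     f (t *\<^sub>R x + (1 - t) *\<^sub>R y) \<le>
       t * f x + (1 - t) * f y - 1/2 * \<eta> * t * (1 - t) * (norm (x - y))\<^sup>2)"

text \<open>Twice continuously differentiable on \<open>S\<close>; at the end points of an interval
  the derivatives are one-sided.\<close>

definition C2_on :: "real set \<Rightarrow> (real \<Rightarrow> real) \<Rightarrow> bool" where
  "C2_on S f \<longleftrightarrow> (\<exists>f' f''.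
     (\<forall>x\<in>S. (f has_real_derivative f' x) (at x within S)) \<and>
     (\<forall>x\<in>S. (f' has_real_derivative f'' x) (at x within S)) \<and>
     continuous_on S f'')"

definition loc_lipschitz :: "('a::metric_space \<Rightarrow> 'b::metric_space) \<Rightarrow> bool" where
  "loc_lipschitz F \<longleftrightarrow> (\<forall>x. \<exists>r>0. \<exists>L. L-lipschitz_on (ball x r) F)"

definition C11 :: "('a::real_normed_vector \<Rightarrow> real) \<Rightarrow> bool" where
  "C11 f \<longleftrightarrow> (\<exists>f' :: 'a \<Rightarrow> 'a \<Rightarrow>\<^sub>L real.
     (\<forall>x. (f has_derivative blinfun_apply (f' x)) (at x)) \<and> loc_lipschitz f')"

text \<open>For \<open>f\<close> on a finite-dimensional space; level \<open>Suc n\<close> requires Frechet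
  differentiability with all directional derivatives of class \<open>n\<close>, which there is the
  same as the derivative being of class \<open>n\<close>.\<close>

primrec Ck :: "nat \<Rightarrow> ('a::euclidean_space \<Rightarrow> real) \<Rightarrow> bool" where
  "Ck 0 f \<longleftrightarrow> continuous_on UNIV f"
| "Ck (Suc n) f \<longleftrightarrow> (\<forall>x. f differentiable (at x)) \<and>
     (\<forall>v. Ck n (\<lambda>x. frechet_derivative f (at x) v))"

definition C_infinity :: "('a::euclidean_space \<Rightarrow> real) \<Rightarrow> bool" where
  "C_infinity f \<longleftrightarrow> (\<forall>n. Ck n f)"

definition quadratic_form :: "('a::real_vector \<Rightarrow> real) \<Rightarrow> bool" where
  "quadratic_form f \<longleftrightarrow> (\<exists>B. bilinear B \<and> (\<forall>x. f x = B x x))"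

text \<open>The gradient with respect to the inner product of the space; meaningful only where
  the function is differentiable.\<close>

definition grad :: "('a::real_inner \<Rightarrow> real) \<Rightarrow> 'a \<Rightarrow> 'a" where
  "grad f x = (THE D. GDERIV f x :> D)"

text \<open>Clarke's generalized Jacobian: the convex hull of all limits of derivatives along
  sequences of points of differentiability.\<close>

definition clarke_jacobian ::
    "('a::euclidean_space \<Rightarrow> 'b::euclidean_space) \<Rightarrow> 'a \<Rightarrow> ('a \<Rightarrow>\<^sub>L 'b) set" where
  "clarke_jacobian F x = convex hull {G. \<exists>X D. X \<longlonglongrightarrow> x \<and>
     (\<forall>n::nat. (F has_derivative blinfun_apply (D n)) (at (X n))) \<and> D \<longlonglongrightarrow> G}"

text \<open>Positive null sequences \<open>t\<close> need not be monotone; passing to subsequences shows that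
  restricting to decreasing ones gives the same notion.\<close>

definition semismooth :: "('a::euclidean_space \<Rightarrow> 'b::euclidean_space) \<Rightarrow> bool" where
  "semismooth F \<longleftrightarrow> loc_lipschitz F \<and>
     (\<forall>A V. \<exists>l. \<forall>Vs t G.
        Vs \<longlonglongrightarrow> V \<and> (\<forall>n::nat. 0 < t n) \<and> t \<longlonglongrightarrow> (0::real) \<and>
        (\<forall>n. G n \<in> clarke_jacobian F (A + t n *\<^sub>R Vs n))
        \<longrightarrow> (\<lambda>n. blinfun_apply (G n) (Vs n)) \<longlonglongrightarrow> l)"

section \<open>The energy density with isotropic volumetric splitting\<close>

definition psi0 :: "real \<Rightarrow> real \<Rightarrow> 'm::finite symmat \<Rightarrow> real" where
  "psi0 \<mu> lam \<epsilon> = lam / 2 * (tr \<epsilon>)\<^sup>2 + \<mu> * trace (mat_of \<epsilon> ** mat_of \<epsilon>)"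

definition psi0_plus :: "real \<Rightarrow> real \<Rightarrow> 'm::finite symmat \<Rightarrow> real" where
  "psi0_plus \<mu> lam \<epsilon> = (\<mu> / real CARD('m) + lam / 2) * (tr \<epsilon>)\<^sup>2"

definition psi0_minus :: "real \<Rightarrow> 'm::finite symmat \<Rightarrow> real" where
  "psi0_minus \<mu> \<epsilon> = \<mu> * (dev \<epsilon> \<bullet> dev \<epsilon>)"

definition psi ::
    "real \<Rightarrow> real \<Rightarrow> (real \<Rightarrow> real) \<Rightarrow> real \<Rightarrow> 'm::finite symmat \<Rightarrow> real \<Rightarrow> real" where
  "psi \<mu> lam g k \<epsilon> d = (g d + k) * psi0_plus \<mu> lam \<epsilon> + (1 + k) * psi0_minus \<mu> \<epsilon>"

end

theory Submission
  imports Defs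
begin

text \<open>
  For fixed \<open>d\<close> the density is a quadratic form: \<open>psi \<epsilon> d = 1/2 * (H \<epsilon> \<bullet> \<epsilon>)\<close> with the
  self-adjoint linear map \<open>H = stress\<close>, which is therefore the gradient. Everything about the
  regularity in \<open>\<epsilon>\<close> is linear algebra from there on: a linear gradient is Lipschitz, its Clarke
  Jacobian is the singleton of itself, which makes semismoothness the continuity of \<open>H\<close>, and
  all derivatives of order three vanish. The Lipschitz constant is uniform in \<open>d\<close> because \<open>d\<close>
  enters \<open>H\<close> only through \<open>g d \<in> {0..1}\<close>, and affinely. For the same reason the dependence on
  \<open>d\<close> is as smooth as \<open>g\<close>.

  A quadratic form \<open>f\<close> satisfies \<open>t * f x + (1 - t) * f y - f (t x + (1 - t) y) = t * (1 - t) *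
  f (x - y)\<close>, so uniform strong convexity and the uniform quadratic lower bound are one and the
  same property. The lower bound comes from the unsplit density. Because \<open>dev\<close> is an orthogonal
  projection, \<open>psi0\<close> is the sum of its two parts, and strong convexity of \<open>psi0\<close> makes it
  coercive. Testing coercivity at the identity matrix, where the deviatoric part vanishes, shows
  that the volumetric modulus \<open>\<mu> / m + lam / 2\<close> is positive. Hence both parts are nonnegative,
  and since their weights \<open>g d + k\<close> and \<open>1 + k\<close> are at least \<open>k\<close>, the density dominates
  \<open>k * psi0\<close>.
\<close>

section \<open>Quadratic forms on Euclidean spaces\<close>

lemma GDERIV_half_quadratic:
  fixes H :: "'a::real_inner \<Rightarrow> 'a"
  assumes "bounded_linear H" and "\<And>x y. H x \<bullet> y = x \<bullet> H y"
  shows "GDERIV (\<lambda>x. 1/2 * (H x \<bullet> x)) x :> H x"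
proof -
  have "((\<lambda>x. 1/2 * (H x \<bullet> x)) has_derivative (\<lambda>h. 1/2 * (H x \<bullet> h + H h \<bullet> x))) (at x)"
    by (auto intro!: derivative_eq_intros bounded_linear.has_derivative[OF assms(1)])
  moreover have "1/2 * (H x \<bullet> h + H h \<bullet> x) = h \<bullet> H x" for h
    using assms(2)[of h x] by (simp add: inner_commute)
  ultimately show ?thesis
    by (simp add: gderiv_def)
qed

lemma grad_eqI:
  assumes "GDERIV f x :> D"
  shows "grad f x = D"
  unfolding grad_def
proof (rule the_equality)
  fix E assume "GDERIV f x :> E"
  then have "(\<lambda>h. h \<bullet> E) = (\<lambda>h. h \<bullet> D)"
    using assms unfolding gderiv_def by (blast intro: has_derivative_unique)
  then show "E = D"
    by (simp add: fun_eq_iff vector_eq_ldot)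
qed (fact assms)

lemma grad_half_quadratic:
  assumes "bounded_linear H" and "\<And>x y. H x \<bullet> y = x \<bullet> H y"
  shows "grad (\<lambda>x. 1/2 * (H x \<bullet> x)) = H"
  using GDERIV_half_quadratic[OF assms] by (intro ext grad_eqI)

lemma loc_lipschitz_bounded_linear:
  assumes "bounded_linear F"
  shows "loc_lipschitz F"
proof -
  obtain L where "L \<ge> 0" "\<And>x. norm (F x) \<le> norm x * L"
    using bounded_linear.nonneg_bounded[OF assms] by blast
  then have "L-lipschitz_on S F" for S
    by (intro lipschitz_onI)
      (simp_all add: dist_norm linear_diff[OF bounded_linear.linear[OF assms], symmetric] mult.commute)
  then show ?thesis
    unfolding loc_lipschitz_def by (meson zero_less_one)
qed

lemma C11_half_quadratic:
  fixes H :: "'a::real_inner \<Rightarrow> 'a"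
  assumes "bounded_linear H" and "\<And>x y. H x \<bullet> y = x \<bullet> H y"
  shows "C11 (\<lambda>x. 1/2 * (H x \<bullet> x))"
  unfolding C11_def
proof (intro exI[of _ "\<lambda>x. blinfun_inner_right (H x)"] conjI allI)
  show "((\<lambda>x. 1/2 * (H x \<bullet> x)) has_derivative blinfun_apply (blinfun_inner_right (H x))) (at x)" for x
  proof -
    have "blinfun_apply (blinfun_inner_right (H x)) = (\<lambda>h. h \<bullet> H x)"
      by (simp add: fun_eq_iff inner_commute)
    then show ?thesis
      using GDERIV_half_quadratic[OF assms] by (simp add: gderiv_def)
  qed
  show "loc_lipschitz (\<lambda>x. blinfun_inner_right (H x))"
    by (intro loc_lipschitz_bounded_linear
        bounded_linear_compose[OF bounded_linear_blinfun_inner_right] assms(1))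
qed

text \<open>A linear map is its own derivative everywhere, so the limits of derivatives, and with them
  their convex hull, collapse to that map.\<close>

lemma clarke_jacobian_bounded_linear:
  assumes "bounded_linear F" and "G \<in> clarke_jacobian F x"
  shows "blinfun_apply G = F"
proof -
  have D_eq: "D = Blinfun F" if "(F has_derivative blinfun_apply D) (at y)" for D y
    using has_derivative_unique[OF that bounded_linear_imp_has_derivative[OF assms(1)]]
    by (metis blinfun_apply_inverse)
  have "{G. \<exists>X D. X \<longlonglongrightarrow> x \<and> (\<forall>n::nat. (F has_derivative blinfun_apply (D n)) (at (X n)))
      \<and> D \<longlonglongrightarrow> G} \<subseteq> {Blinfun F}"
  proof clarify
    fix G X D
    assume "\<forall>n::nat. (F has_derivative blinfun_apply (D n)) (at (X n))" and lim: "D \<longlonglongrightarrow> G"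
    then have "D = (\<lambda>_. Blinfun F)"
      using D_eq by blast
    then show "G = Blinfun F"
      using lim by (simp add: LIMSEQ_const_iff)
  qed
  then have "clarke_jacobian F x \<subseteq> {Blinfun F}"
    unfolding clarke_jacobian_def by (rule hull_minimal) simp
  then show ?thesis
    using assms by (auto simp: bounded_linear_Blinfun_apply)
qed

lemma semismooth_bounded_linear:
  assumes "bounded_linear F"
  shows "semismooth F"
  unfolding semismooth_def
proof (intro conjI allI loc_lipschitz_bounded_linear[OF assms])
  fix A V
  show "\<exists>l. \<forall>Vs t G. Vs \<longlonglongrightarrow> V \<and> (\<forall>n::nat. 0 < t n) \<and> t \<longlonglongrightarrow> (0::real) \<and>
      (\<forall>n. G n \<in> clarke_jacobian F (A + t n *\<^sub>R Vs n))
      \<longrightarrow> (\<lambda>n. blinfun_apply (G n) (Vs n)) \<longlonglongrightarrow> l"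
  proof (intro exI[of _ "F V"] allI impI, elim conjE)
    fix Vs t G
    assume "Vs \<longlonglongrightarrow> V" and G: "\<forall>n. G n \<in> clarke_jacobian F (A + t n *\<^sub>R Vs n)"
    have "blinfun_apply (G n) = F" for n
      using clarke_jacobian_bounded_linear[OF assms G[rule_format]] .
    then show "(\<lambda>n. blinfun_apply (G n) (Vs n)) \<longlonglongrightarrow> F V"
      using bounded_linear.tendsto[OF assms \<open>Vs \<longlonglongrightarrow> V\<close>] by simp
  qed
qed

lemma Ck_const: "Ck n (\<lambda>_. c)"
  by (induction n arbitrary: c) (simp_all)

lemma Ck_bounded_linear:
  assumes "bounded_linear f"
  shows "Ck n f"
proof (cases n)
  case 0
  then show ?thesis
    using assms by (simp add: linear_continuous_on)
next
  case (Suc m)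
  have "(f has_derivative f) (at x)" for x
    using assms by (rule bounded_linear_imp_has_derivative)
  then show ?thesis
    using frechet_derivative_at[of f f] by (auto simp: Suc Ck_const differentiable_def)
qed

lemma C_infinity_half_quadratic:
  fixes H :: "'a::euclidean_space \<Rightarrow> 'a"
  assumes "bounded_linear H" and "\<And>x y. H x \<bullet> y = x \<bullet> H y"
  shows "C_infinity (\<lambda>x. 1/2 * (H x \<bullet> x))"
  unfolding C_infinity_def
proof
  let ?f = "\<lambda>x. 1/2 * (H x \<bullet> x)"
  fix n
  have deriv: "(?f has_derivative (\<lambda>h. h \<bullet> H x)) (at x)" for x
    using GDERIV_half_quadratic[OF assms] by (simp add: gderiv_def)
  show "Ck n ?f"
  proof (cases n)
    case 0
    have "continuous_on UNIV ?f"
      using deriv by (blast intro: has_derivative_continuous continuous_at_imp_continuous_on)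
    then show ?thesis
      by (simp add: 0)
  next
    case (Suc m)
    have "Ck m (\<lambda>x. frechet_derivative ?f (at x) v)" for v
    proof -
      have "(\<lambda>x. frechet_derivative ?f (at x) v) = (\<lambda>x. v \<bullet> H x)"
        unfolding frechet_derivative_at[OF deriv, symmetric] ..
      moreover have "bounded_linear (\<lambda>x. v \<bullet> H x)"
        by (rule bounded_linear_compose[OF bounded_linear_inner_right assms(1)])
      ultimately show ?thesis
        by (simp add: Ck_bounded_linear)
    qed
    moreover have "?f differentiable (at x)" for x
      using deriv by (auto simp: differentiable_def)
    ultimately show ?thesis
      unfolding Suc Ck.simps by blast
  qed
qed

lemma quadratic_form_half_quadratic:
  fixes H :: "'a::real_inner \<Rightarrow> 'a"
  assumes "linear H"
  shows "quadratic_form (\<lambda>x. 1/2 * (H x \<bullet> x))"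
  unfolding quadratic_form_def bilinear_def
  using assms
  by (intro exI[of _ "\<lambda>x y. 1/2 * (H x \<bullet> y)"])
    (auto intro!: linearI simp: linear_add linear_scale inner_add algebra_simps)

text \<open>With this identity a lower bound \<open>C * (norm x)\<^sup>2\<close> of the form turns into strong convexity with
  modulus \<open>2 * C\<close>.\<close>

lemma half_quadratic_convexity_gap:
  fixes H :: "'a::real_inner \<Rightarrow> 'a" and t :: real
  assumes "linear H"
  shows "1/2 * (H (t *\<^sub>R x + (1 - t) *\<^sub>R y) \<bullet> (t *\<^sub>R x + (1 - t) *\<^sub>R y)) =
    t * (1/2 * (H x \<bullet> x)) + (1 - t) * (1/2 * (H y \<bullet> y))
      - t * (1 - t) * (1/2 * (H (x - y) \<bullet> (x - y)))"
  by (simp add: linear_add[OF assms] linear_diff[OF assms] linear_scale[OF assms]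
      inner_add inner_diff field_simps)

text \<open>Comparing the values at \<open>x\<close>, \<open>0\<close> and their midpoint, where 2-homogeneity gives a quarter of
  the value at \<open>x\<close>, extracts coercivity from strong convexity.\<close>

lemma strongly_convex_homogeneous_coercive:
  assumes "strongly_convex f" and "\<And>c x. f (c *\<^sub>R x) = c\<^sup>2 * f x"
  obtains C where "C > 0" and "\<And>x. f x \<ge> C * (norm x)\<^sup>2"
proof -
  obtain \<eta> where "\<eta> > 0" and \<eta>: "\<And>x y t. t \<in> {0..1} \<Longrightarrow>
      f (t *\<^sub>R x + (1 - t) *\<^sub>R y) \<le>
        t * f x + (1 - t) * f y - 1/2 * \<eta> * t * (1 - t) * (norm (x - y))\<^sup>2"
    using assms(1) unfolding strongly_convex_def by blast
  have "f x \<ge> \<eta> / 2 * (norm x)\<^sup>2" for x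
    using \<eta>[of "1/2" x 0] assms(2)[of "1/2" x] assms(2)[of 0 0] by (simp add: power2_eq_square)
  then show ?thesis
    using \<open>\<eta> > 0\<close> that[of "\<eta> / 2"] by simp
qed

section \<open>Trace, deviator and the stress\<close>

text \<open>As the trace is the inner product with the identity, linearity and boundedness of \<open>tr\<close> and
  \<open>dev\<close> are inherited from the inner product.\<close>

lemma tr_eq_inner: "tr A = Id_symmat \<bullet> A"
  by (simp add: tr_def inner_symmat_def Id_symmat.rep_eq)

lemma inner_Id_Id: "Id_symmat \<bullet> (Id_symmat :: 'm::finite symmat) = real CARD('m)"
  unfolding tr_eq_inner[symmetric]
  by (simp add: tr_def Id_symmat.rep_eq trace_def mat_def)

lemma dev_Id: "dev (Id_symmat :: 'm::finite symmat) = 0"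
  by (simp add: dev_def tr_eq_inner inner_Id_Id)

lemma bounded_linear_tr: "bounded_linear tr"
  unfolding tr_eq_inner[abs_def] by (rule bounded_linear_inner_right)

lemma bounded_linear_dev: "bounded_linear (dev :: 'm::finite symmat \<Rightarrow> 'm symmat)"
proof -
  have "bounded_linear (\<lambda>A :: 'm symmat. (tr A / real CARD('m)) *\<^sub>R (Id_symmat :: 'm symmat))"
    by (intro bounded_linear_scaleR_const bounded_linear_divide[THEN bounded_linear_compose]
        bounded_linear_tr)
  then show ?thesis
    unfolding dev_def[abs_def] by (intro bounded_linear_sub bounded_linear_ident)
qed

lemma dev_self_adjoint: "dev A \<bullet> B = A \<bullet> dev B"
  by (simp add: dev_def tr_eq_inner inner_diff inner_commute)

lemma inner_dev_dev:
  fixes A :: "'m::finite symmat"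
  shows "dev A \<bullet> dev A = A \<bullet> A - (tr A)\<^sup>2 / real CARD('m)"
  by (simp add: dev_def tr_eq_inner inner_diff inner_Id_Id inner_commute power2_eq_square)

lemma inner_dev_left: "dev A \<bullet> A = dev A \<bullet> dev A"
  by (simp add: inner_dev_dev) (simp add: dev_def tr_eq_inner inner_diff power2_eq_square)

lemma psi0_split: "psi0 \<mu> lam \<epsilon> = psi0_plus \<mu> lam \<epsilon> + psi0_minus \<mu> (\<epsilon> :: 'm::finite symmat)"
proof -
  have "trace (mat_of \<epsilon> ** mat_of \<epsilon>) = \<epsilon> \<bullet> \<epsilon>"
    by (simp add: inner_symmat_def)
  then show ?thesis
    by (simp add: psi0_def psi0_plus_def psi0_minus_def inner_dev_dev algebra_simps)
qed

lemma psi0_scaleR: "psi0 \<mu> lam (c *\<^sub>R \<epsilon>) = c\<^sup>2 * psi0 \<mu> lam (\<epsilon> :: 'm::finite symmat)"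
  by (simp add: psi0_split psi0_plus_def psi0_minus_def tr_eq_inner power2_eq_square
      linear_scale[OF bounded_linear.linear[OF bounded_linear_dev]] algebra_simps)

text \<open>The gradient of \<open>psi\<close> in the strain, that is, the Cauchy stress. The parameter \<open>s\<close> stands
  for the degradation factor \<open>g d\<close>.\<close>

definition stress :: "real \<Rightarrow> real \<Rightarrow> real \<Rightarrow> real \<Rightarrow> 'm::finite symmat \<Rightarrow> 'm symmat" where
  "stress \<mu> lam k s \<epsilon> =
     (2 * (s + k) * (\<mu> / real CARD('m) + lam / 2) * tr \<epsilon>) *\<^sub>R Id_symmat
     + (2 * (1 + k) * \<mu>) *\<^sub>R dev \<epsilon>"

lemma bounded_linear_stress: "bounded_linear (stress \<mu> lam k s :: 'm::finite symmat \<Rightarrow> _)"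
  unfolding stress_def[abs_def]
  by (intro bounded_linear_add bounded_linear_scaleR_const bounded_linear_const_mult
      bounded_linear_tr bounded_linear_const_scaleR bounded_linear_dev)

lemma stress_self_adjoint: "stress \<mu> lam k s A \<bullet> B = A \<bullet> stress \<mu> lam k s B"
  by (simp add: stress_def tr_eq_inner inner_add dev_self_adjoint inner_commute[of _ Id_symmat])

lemma psi_eq_half_stress: "psi \<mu> lam g k \<epsilon> d = 1/2 * (stress \<mu> lam k (g d) \<epsilon> \<bullet> \<epsilon>)"
  by (simp add: psi_def psi0_plus_def psi0_minus_def stress_def inner_add inner_dev_left
      tr_eq_inner[symmetric] power2_eq_square)
    (simp add: algebra_simps add_divide_distrib)

lemma stress_bound_uniform:
  obtains L where "L \<ge> 0" and
    "\<And>s A :: 'm::finite symmat. s \<in> {0..1} \<Longrightarrow> norm (stress \<mu> lam k s A) \<le> L * norm A"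
proof -
  obtain K\<^sub>0 where K0: "K\<^sub>0 \<ge> 0" "\<And>A :: 'm symmat. norm (stress \<mu> lam k 0 A) \<le> norm A * K\<^sub>0"
    using bounded_linear.nonneg_bounded[OF bounded_linear_stress] by blast
  obtain K\<^sub>1 where K1: "K\<^sub>1 \<ge> 0" "\<And>A :: 'm symmat. norm (stress \<mu> lam k 1 A) \<le> norm A * K\<^sub>1"
    using bounded_linear.nonneg_bounded[OF bounded_linear_stress] by blast
  have "norm (stress \<mu> lam k s A) \<le> (K\<^sub>0 + K\<^sub>1) * norm A" if "s \<in> {0..1}" for s and A :: "'m symmat"
  proof -
    \<comment> \<open>The stress is affine in \<open>s\<close>, so the two endpoint bounds control all \<open>s\<close> in between.\<close>
    have "stress \<mu> lam k s A = (1 - s) *\<^sub>R stress \<mu> lam k 0 A + s *\<^sub>R stress \<mu> lam k 1 A"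
      by (simp add: stress_def scaleR_add_right flip: scaleR_add_left)
        (simp add: algebra_simps add_divide_distrib diff_divide_distrib flip: scaleR_add_left)
    also have "norm \<dots> \<le> (1 - s) * norm (stress \<mu> lam k 0 A) + s * norm (stress \<mu> lam k 1 A)"
      using that by (intro norm_triangle_le) simp
    also have "\<dots> \<le> 1 * (norm A * K\<^sub>0) + 1 * (norm A * K\<^sub>1)"
      using that K0 K1 by (intro add_mono mult_mono) auto
    finally show ?thesis
      by (simp add: algebra_simps)
  qed
  then show ?thesis
    using K0(1) K1(1) that[of "K\<^sub>0 + K\<^sub>1"] by simp
qed

section \<open>Uniform coercivity and regularity in the damage variable\<close>

lemma psi_coercive_uniform:
  assumes "\<mu> > 0" and "strongly_convex (psi0 \<mu> lam :: 'm::finite symmat \<Rightarrow> real)"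
    and "g ` {0..1} \<subseteq> {0..1}" and "k > 0"
  obtains C where "C > 0" and
    "\<And>d \<epsilon> :: 'm symmat. d \<in> {0..1} \<Longrightarrow> psi \<mu> lam g k \<epsilon> d \<ge> C * (norm \<epsilon>)\<^sup>2"
proof -
  let ?m = "real CARD('m)"
  obtain C where C: "C > 0" "\<And>\<epsilon> :: 'm symmat. psi0 \<mu> lam \<epsilon> \<ge> C * (norm \<epsilon>)\<^sup>2"
    using strongly_convex_homogeneous_coercive[OF assms(2) psi0_scaleR] by blast
  \<comment> \<open>At the identity only the volumetric part of the energy is left.\<close>
  have "C * ?m \<le> (\<mu> / ?m + lam / 2) * ?m\<^sup>2"
    using C(2)[of Id_symmat]
    by (simp add: psi0_split psi0_plus_def psi0_minus_def dev_Id tr_eq_inner inner_Id_Id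
        power2_norm_eq_inner)
  moreover have "C * ?m > 0"
    using C(1) by simp
  ultimately have "(\<mu> / ?m + lam / 2) * ?m\<^sup>2 > 0"
    by linarith
  then have modulus_pos: "\<mu> / ?m + lam / 2 > 0"
    by (simp add: zero_less_mult_iff)
  have "psi \<mu> lam g k \<epsilon> d \<ge> k * C * (norm \<epsilon>)\<^sup>2" if "d \<in> {0..1}" for d and \<epsilon> :: "'m symmat"
  proof -
    have "g d \<ge> 0"
      using assms(3) that by (auto simp: image_subset_iff)
    have "k * C * (norm \<epsilon>)\<^sup>2 \<le> k * psi0 \<mu> lam \<epsilon>"
      using C(2)[of \<epsilon>] \<open>k > 0\<close> by (simp add: mult.assoc)
    also have "\<dots> = k * psi0_plus \<mu> lam \<epsilon> + k * psi0_minus \<mu> \<epsilon>"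
      by (simp add: psi0_split distrib_left)
    also have "\<dots> \<le> psi \<mu> lam g k \<epsilon> d"
      unfolding psi_def
    proof (intro add_mono mult_right_mono)
      show "psi0_plus \<mu> lam \<epsilon> \<ge> 0"
        using modulus_pos by (simp add: psi0_plus_def)
      show "psi0_minus \<mu> \<epsilon> \<ge> 0"
        using \<open>\<mu> > 0\<close> by (simp add: psi0_minus_def)
    qed (use \<open>g d \<ge> 0\<close> in auto)
    finally show ?thesis .
  qed
  then show ?thesis
    using C(1) \<open>k > 0\<close> that[of "k * C"] by simp
qed

lemma C2_on_affine:
  assumes "C2_on S g"
  shows "C2_on S (\<lambda>d. (g d + k) * a + b)"
proof -
  obtain g' g'' where
    "\<And>x. x \<in> S \<Longrightarrow> (g has_real_derivative g' x) (at x within S)"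
    "\<And>x. x \<in> S \<Longrightarrow> (g' has_real_derivative g'' x) (at x within S)"
    "continuous_on S g''"
    using assms unfolding C2_on_def by blast
  then show ?thesis
    unfolding C2_on_def
    by (intro exI[of _ "\<lambda>x. g' x * a"] exI[of _ "\<lambda>x. g'' x * a"])
      (auto intro!: derivative_eq_intros continuous_intros)
qed

theorem lemma2p7:
  fixes \<mu> lam k :: real and g :: "real \<Rightarrow> real"
  assumes "\<mu> > 0" and "lam > - (2/3) * \<mu>"
    and "strongly_convex (psi0 \<mu> lam :: 'm::finite symmat \<Rightarrow> real)"
    and "g ` {0..1} \<subseteq> {0..1}" and "convex_on {0..1} g" and "C2_on {0..1} g"
    and "antimono_on {0..1} g" and "g 0 = 1" and "g 1 = 0"
    and "k > 0"
  shows
    "(\<forall>\<epsilon> :: 'm symmat. C2_on {0..1} (\<lambda>d. psi \<mu> lam g k \<epsilon> d)) \<and>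
     (\<forall>d\<in>{0..1}. C11 (\<lambda>\<epsilon> :: 'm symmat. psi \<mu> lam g k \<epsilon> d)) \<and>
     (\<forall>d\<in>{0..1}. semismooth (grad (\<lambda>\<epsilon> :: 'm symmat. psi \<mu> lam g k \<epsilon> d))) \<and>
     (\<exists>L\<ge>0. \<forall>d\<in>{0..1}. \<forall>A B :: 'm symmat.
        norm (grad (\<lambda>\<epsilon>. psi \<mu> lam g k \<epsilon> d) A - grad (\<lambda>\<epsilon>. psi \<mu> lam g k \<epsilon> d) B)
          \<le> L * norm (A - B)) \<and>
     (\<exists>\<eta>>0. \<forall>d\<in>{0..1}. \<forall>A B :: 'm symmat. \<forall>t\<in>{0..1}.
        psi \<mu> lam g k (t *\<^sub>R A + (1 - t) *\<^sub>R B) d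
          \<le> t * psi \<mu> lam g k A d + (1 - t) * psi \<mu> lam g k B d
             - 1/2 * \<eta> * t * (1 - t) * (norm (A - B))\<^sup>2) \<and>
     (\<exists>C>0. \<forall>d\<in>{0..1}. \<forall>\<epsilon> :: 'm symmat. psi \<mu> lam g k \<epsilon> d \<ge> C * (norm \<epsilon>)\<^sup>2) \<and>
     (\<forall>d\<in>{0..1}. C_infinity (\<lambda>\<epsilon> :: 'm symmat. psi \<mu> lam g k \<epsilon> d) \<and>
        quadratic_form (\<lambda>\<epsilon> :: 'm symmat. psi \<mu> lam g k \<epsilon> d))"
proof -
  let ?H = "\<lambda>d. stress \<mu> lam k (g d) :: 'm symmat \<Rightarrow> 'm symmat"
  note lin = bounded_linear_stress[of \<mu> lam k] and adj = stress_self_adjoint[of \<mu> lam k]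
  have grad_psi: "grad (\<lambda>\<epsilon> :: 'm symmat. psi \<mu> lam g k \<epsilon> d) = ?H d" for d
    unfolding psi_eq_half_stress by (rule grad_half_quadratic[OF lin adj])
  have in_unit: "g d \<in> {0..1}" if "d \<in> {0..1}" for d
    using \<open>g ` {0..1} \<subseteq> {0..1}\<close> that by blast
  obtain C where C: "C > 0" "\<And>d \<epsilon> :: 'm symmat. d \<in> {0..1} \<Longrightarrow> psi \<mu> lam g k \<epsilon> d \<ge> C * (norm \<epsilon>)\<^sup>2"
    using psi_coercive_uniform[OF assms(1,3,4,10)] by blast
  obtain L where L: "L \<ge> 0"
      "\<And>s A :: 'm symmat. s \<in> {0..1} \<Longrightarrow> norm (stress \<mu> lam k s A) \<le> L * norm A"
    using stress_bound_uniform by blast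
  show ?thesis
  proof (intro conjI allI ballI)
    show "C2_on {0..1} (\<lambda>d. psi \<mu> lam g k \<epsilon> d)" for \<epsilon> :: "'m symmat"
      unfolding psi_def by (rule C2_on_affine) fact
    show "C11 (\<lambda>\<epsilon> :: 'm symmat. psi \<mu> lam g k \<epsilon> d)" for d
      unfolding psi_eq_half_stress by (rule C11_half_quadratic[OF lin adj])
    show "semismooth (grad (\<lambda>\<epsilon> :: 'm symmat. psi \<mu> lam g k \<epsilon> d))" for d
      unfolding grad_psi by (rule semismooth_bounded_linear[OF lin])
    show "\<exists>L\<ge>0. \<forall>d\<in>{0..1}. \<forall>A B :: 'm symmat.
        norm (grad (\<lambda>\<epsilon>. psi \<mu> lam g k \<epsilon> d) A - grad (\<lambda>\<epsilon>. psi \<mu> lam g k \<epsilon> d) B)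
          \<le> L * norm (A - B)"
      unfolding grad_psi linear_diff[OF bounded_linear.linear[OF lin], symmetric]
      using L in_unit by blast
    show "\<exists>\<eta>>0. \<forall>d\<in>{0..1}. \<forall>A B :: 'm symmat. \<forall>t\<in>{0..1}.
        psi \<mu> lam g k (t *\<^sub>R A + (1 - t) *\<^sub>R B) d
          \<le> t * psi \<mu> lam g k A d + (1 - t) * psi \<mu> lam g k B d
             - 1/2 * \<eta> * t * (1 - t) * (norm (A - B))\<^sup>2"
    proof (intro exI[of _ "2 * C"] conjI ballI allI)
      fix d t :: real and A B :: "'m symmat"
      assume "d \<in> {0..1}" and "t \<in> {0..1}"
      then have "t * (1 - t) * (C * (norm (A - B))\<^sup>2) \<le> t * (1 - t) * psi \<mu> lam g k (A - B) d"
        using C(2) by (intro mult_left_mono) auto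
      then show "psi \<mu> lam g k (t *\<^sub>R A + (1 - t) *\<^sub>R B) d
          \<le> t * psi \<mu> lam g k A d + (1 - t) * psi \<mu> lam g k B d
             - 1/2 * (2 * C) * t * (1 - t) * (norm (A - B))\<^sup>2"
        unfolding psi_eq_half_stress half_quadratic_convexity_gap[OF bounded_linear.linear[OF lin]]
        by (simp add: mult_ac)
    qed (use C(1) in simp)
    show "\<exists>C>0. \<forall>d\<in>{0..1}. \<forall>\<epsilon> :: 'm symmat. psi \<mu> lam g k \<epsilon> d \<ge> C * (norm \<epsilon>)\<^sup>2"
      using C by blast
    show "C_infinity (\<lambda>\<epsilon> :: 'm symmat. psi \<mu> lam g k \<epsilon> d)" for d
      unfolding psi_eq_half_stress by (rule C_infinity_half_quadratic[OF lin adj])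
    show "quadratic_form (\<lambda>\<epsilon> :: 'm symmat. psi \<mu> lam g k \<epsilon> d)" for d
      unfolding psi_eq_half_stress
      by (rule quadratic_form_half_quadratic[OF bounded_linear.linear[OF lin]])
  qed
qed

end
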